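(* Let $\rho>0$ and let $G\not\equiv 0$ be a locally integrable completely monotonic relaxation modulus, with associated dispersion-attenuation spectral measure $\nu$, attenuation function $\mathcal A$ and dispersion function $\mathcal D$. Assume that the $\nu$-measure of the closed segment $[0,r]$ is a regularly varying function of $r$ at infinity with index $1-\alpha$, that is, $\nu([0,r])\sim r^{1-\alpha}\,l(r)$ as $r\to\infty$, where $l$ is slowly varying at infinity. Then $\mathcal A$ and $\mathcal D$ satisfy the Kramers-Kronig dispersion relation with one subtraction: for real $\omega\ne\omega_0$, $$\mathcal{A}(\omega)-\mathcal{A}(\omega_0)=-\frac{\omega-\omega_0}{\pi}\,\mathrm{vp}\int_{-\infty}^{\infty}\frac{\mathcal{D}(\omega')-\mathcal{D}(\omega_0)}{(\omega'-\omega_0)(\omega'-\omega)}\,d\omega',$$ where $\mathrm{vp}$ indicates that the integral is taken in the sense of principal value.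
   Context: A function $f$ on $(0,\infty)$ is completely monotonic if it is infinitely differentiable and $(-1)^n f^{(n)}\ge0$ for all $n\ge0$; it is locally integrable if it is integrable over $[0,1]$. For such $G$, let $Q(p):=p\tilde G(p)$, where $\tilde G(p)=\int_0^\infty G(t)e^{-pt}\,dt$ (analytically continued to $\mathbb{C}\setminus(-\infty,0]$), and let $\kappa(p):=\rho^{1/2}p/Q(p)^{1/2}$ be the complex wave number function, the square root being chosen so that $\operatorname{Re}\kappa(-i\omega)\ge0$ for real $\omega$. There are a unique $B\ge0$ and a unique positive Radon measure $\nu$ on $(0,\infty)$ (the dispersion-attenuation spectral measure) with $\int_{(0,\infty)}\nu(dr)/(1+r)<\infty$ such that $\kappa(p)=Bp+\beta(p)$, where $\beta(p)=p\int_{(0,\infty)}\nu(dr)/(p+r)$. The measure $\nu$ is regarded as a measure on $[0,\infty)$ with $\nu(\{0\})=0$. For real $\omega$, $\mathcal A(\omega):=\operatorname{Re}\beta(-i\omega)=\omega^2\int_{(0,\infty)}\frac{\nu(dr)}{\omega^2+r^2}$ and $\mathcal D(\omega):=-\operatorname{Im}\beta(-i\omega)=\omega\int_{(0,\infty)}\frac{r\,\nu(dr)}{\omega^2+r^2}$ (both equal to $0$ at $\omega=0$). Here $\alpha$ is a real number. A function $l$ is slowly varying at infinity if $\lim_{x\to\infty}l(\lambda x)/l(x)=1$ for all $\lambda>0$. The relation $f\sim g$ means $f/g\to1$. *)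

theory Defs
  imports "HOL-Complex_Analysis.Complex_Analysis" "HOL-Library.Landau_Symbols"
begin

unbundle asymp_equiv_syntax

text \<open>Functions on \<open>(0,\<infinity>)\<close> are modelled as total functions on the reals whose values
  on \<open>(-\<infinity>,0]\<close> play no role.\<close>

definition completely_monotonic :: "(real \<Rightarrow> real) \<Rightarrow> bool" where
  "completely_monotonic G \<longleftrightarrow>
     (\<forall>n. \<forall>t>0. ((deriv ^^ n) G) field_differentiable (at t) \<and>
               (-1) ^ n * (deriv ^^ n) G t \<ge> 0)"

definition locally_integrable_at_0 :: "(real \<Rightarrow> real) \<Rightarrow> bool" where
  "locally_integrable_at_0 G \<longleftrightarrow> set_integrable lborel {0<..1} G"

definition laplace :: "(real \<Rightarrow> real) \<Rightarrow> complex \<Rightarrow> complex" where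
  "laplace G p = (LINT t:{0<..}|lborel. complex_of_real (G t) * exp (- p * complex_of_real t))"

definition slit_plane :: "complex set" where
  "slit_plane = - \<real>\<^sub>\<le>\<^sub>0"

definition laplace_continuation :: "(real \<Rightarrow> real) \<Rightarrow> (complex \<Rightarrow> complex) \<Rightarrow> bool" where
  "laplace_continuation G Gt \<longleftrightarrow>
     Gt holomorphic_on slit_plane \<and> (\<forall>p. Re p > 0 \<longrightarrow> Gt p = laplace G p)"

text \<open>The square root \<open>S\<close> of \<open>Q(p) = p Gt(p)\<close> is a holomorphic branch on the slit plane. It is
  determined up to a global sign, and the sign is fixed by the condition on \<open>\<kappa>(-i\<omega>)\<close>, except when
  \<open>Re \<kappa>(-i\<omega>)\<close> vanishes identically (\<open>G\<close> constant). The point \<open>p = 0\<close> is not in the slit plane;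
  there \<open>\<kappa>\<close> has the limit 0.\<close>

definition complex_wave_number :: "real \<Rightarrow> (real \<Rightarrow> real) \<Rightarrow> (complex \<Rightarrow> complex) \<Rightarrow> bool" where
  "complex_wave_number \<rho> G \<kappa> \<longleftrightarrow>
     (\<exists>Gt S. laplace_continuation G Gt \<and>
        S holomorphic_on slit_plane \<and>
        (\<forall>p\<in>slit_plane. (S p)\<^sup>2 = p * Gt p) \<and>
        (\<forall>p\<in>slit_plane. \<kappa> p = complex_of_real (sqrt \<rho>) * p / S p) \<and>
        (\<forall>\<omega>::real. \<omega> \<noteq> 0 \<longrightarrow> Re (\<kappa> (- \<i> * complex_of_real \<omega>)) \<ge> 0))"

definition beta :: "real measure \<Rightarrow> complex \<Rightarrow> complex" where
  "beta \<nu> p = p * (LINT r:{0<..}|\<nu>. 1 / (p + complex_of_real r))"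

text \<open>A Radon measure on \<open>(0,\<infinity>)\<close> is represented by a Borel measure on the real line that
  vanishes on \<open>(-\<infinity>,0]\<close> and is finite on compact subsets of \<open>(0,\<infinity>)\<close>.\<close>

definition radon_on_pos :: "real measure \<Rightarrow> bool" where
  "radon_on_pos \<nu> \<longleftrightarrow> sets \<nu> = sets borel \<and> emeasure \<nu> {..0} = 0 \<and>
     (\<forall>K. compact K \<longrightarrow> K \<subseteq> {0<..} \<longrightarrow> emeasure \<nu> K < \<infinity>)"

definition dispersion_attenuation_measure ::
    "real \<Rightarrow> (real \<Rightarrow> real) \<Rightarrow> real measure \<Rightarrow> bool" where
  "dispersion_attenuation_measure \<rho> G \<nu> \<longleftrightarrow>
     radon_on_pos \<nu> \<and> set_integrable \<nu> {0<..} (\<lambda>r. 1 / (1 + r)) \<and>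
     (\<exists>B \<kappa>. B \<ge> 0 \<and> complex_wave_number \<rho> G \<kappa> \<and>
        (\<forall>p\<in>slit_plane. \<kappa> p = complex_of_real B * p + beta \<nu> p))"

definition attenuation :: "real measure \<Rightarrow> real \<Rightarrow> real" where
  "attenuation \<nu> \<omega> = Re (beta \<nu> (- \<i> * complex_of_real \<omega>))"

definition dispersion :: "real measure \<Rightarrow> real \<Rightarrow> real" where
  "dispersion \<nu> \<omega> = - Im (beta \<nu> (- \<i> * complex_of_real \<omega>))"

definition slowly_varying :: "(real \<Rightarrow> real) \<Rightarrow> bool" where
  "slowly_varying l \<longleftrightarrow> (\<forall>c>0. ((\<lambda>x. l (c * x) / l x) \<longlongrightarrow> 1) at_top)"

text \<open>Cauchy principal value over the real line for a singularity at \<open>c\<close>: symmetric truncation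
  both around \<open>c\<close> and at infinity. The truncated integrals are absolutely convergent Lebesgue
  integrals, and the two limits are taken jointly. Truncation at infinity is needed, because
  \<open>\<D>(\<omega>)/\<omega>\<^sup>2\<close> need not be absolutely integrable there (possible when \<open>\<alpha> = 0\<close>).\<close>

definition has_pv_integral :: "(real \<Rightarrow> real) \<Rightarrow> real \<Rightarrow> real \<Rightarrow> bool" where
  "has_pv_integral f c I \<longleftrightarrow>
     (\<forall>\<epsilon>>0. \<forall>R. set_integrable lborel ({-R..R} - {c-\<epsilon><..<c+\<epsilon>}) f) \<and>
     ((\<lambda>(\<epsilon>, R). LINT x:({-R..R} - {c-\<epsilon><..<c+\<epsilon>})|lborel. f x) \<longlongrightarrow> I)
       (at_right 0 \<times>\<^sub>F at_top)"

definition pv_integrable :: "(real \<Rightarrow> real) \<Rightarrow> real \<Rightarrow> bool" where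
  "pv_integrable f c \<longleftrightarrow> (\<exists>I. has_pv_integral f c I)"

definition pv_integral :: "(real \<Rightarrow> real) \<Rightarrow> real \<Rightarrow> real" where
  "pv_integral f c = (THE I. has_pv_integral f c I)"

end

theory Submission
  imports Defs "HOL-Real_Asymp.Real_Asymp"
begin

text \<open>
  The relation holds for each relaxation rate \<open>r\<close> separately, that is, for the Lorentzian pair
  \<open>\<omega>\<^sup>2 / (\<omega>\<^sup>2 + r\<^sup>2)\<close>, \<open>\<omega> r / (\<omega>\<^sup>2 + r\<^sup>2)\<close>: after one subtraction the integrand is a rational function
  of \<open>x\<close> without a pole at \<open>\<omega>\<^sub>0\<close>, and its truncated integral is a sum of logarithms and arctangents.
  By Fubini's theorem the truncated integral for \<open>\<nu>\<close> is the superposition of these. It splits into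
  a term depending only on the truncation at infinity and a term depending only on the excision
  around \<open>\<omega>\<close>, and dominated convergence with a multiple of \<open>1 / (1 + r)\<close> as majorant gives both limits.
\<close>

section \<open>Bounds for the rational kernels\<close>

lemma sum_squares_pos: "0 < (r::real) \<Longrightarrow> 0 < x\<^sup>2 + r\<^sup>2"
  by (simp add: add_nonneg_pos)

text \<open>AM-GM, from (|x| - |r|)^2 \<ge> 0. If \<open>x\<close> and \<open>r\<close> both vanish,
  the quotient is 0 because division by zero yields 0.\<close>

lemma abs_mult_div_sum_squares_le: "\<bar>x * r\<bar> / (x\<^sup>2 + r\<^sup>2) \<le> 1 / (2::real)"
proof (cases "x\<^sup>2 + r\<^sup>2 = 0")
  case False
  then have "x\<^sup>2 + r\<^sup>2 > 0"
    by (metis add_nonneg_nonneg less_eq_real_def zero_le_power2)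
  moreover have "2 * \<bar>x * r\<bar> \<le> x\<^sup>2 + r\<^sup>2"
    using zero_le_power2[of "\<bar>x\<bar> - \<bar>r\<bar>"] by (simp add: power2_diff abs_mult)
  ultimately show ?thesis by (simp add: field_simps)
qed simp

lemma square_div_sum_squares_le: "0 < (r::real) \<Longrightarrow> r\<^sup>2 / (x\<^sup>2 + r\<^sup>2) \<le> 1"
  by (simp add: sum_squares_pos)

text \<open>The summand 1 of the weight is handled by dropping r^2 from the denominator, the summand
  \<open>r\<close> by AM-GM.\<close>

lemma weight_div_sum_squares_le:
  fixes w r :: real
  assumes "w \<noteq> 0" "0 < r"
  shows "(1 + r) / (w\<^sup>2 + r\<^sup>2) \<le> 1 / w\<^sup>2 + 1 / (2 * \<bar>w\<bar>)"
proof -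
  have "1 / (w\<^sup>2 + r\<^sup>2) \<le> 1 / w\<^sup>2"
    using assms by (intro divide_left_mono) (auto simp: sum_squares_pos)
  moreover have "r / (w\<^sup>2 + r\<^sup>2) \<le> 1 / (2 * \<bar>w\<bar>)"
    using abs_mult_div_sum_squares_le[of w r] assms
    by (simp add: field_simps abs_mult sum_squares_pos)
  ultimately show ?thesis
    by (simp add: add_divide_distrib)
qed

text \<open>AM-GM absorbs the summand 1 of the weight, and the summand \<open>r\<close> turns the
  kernel into |x| times a fraction that is at most 1. The case \<open>x = 0\<close> is
  included.\<close>

lemma dispersion_kernel_bound:
  fixes x r :: real
  assumes "0 < r"
  shows "\<bar>x * r / (x\<^sup>2 + r\<^sup>2)\<bar> * (1 + r) \<le> 1 / 2 + \<bar>x\<bar>"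
proof -
  have "\<bar>x * r / (x\<^sup>2 + r\<^sup>2)\<bar> * (1 + r) = \<bar>x * r\<bar> / (x\<^sup>2 + r\<^sup>2) + \<bar>x\<bar> * (r\<^sup>2 / (x\<^sup>2 + r\<^sup>2))"
    using assms by (simp add: abs_mult power2_eq_square algebra_simps add_divide_distrib)
  also have "\<dots> \<le> 1 / 2 + \<bar>x\<bar> * 1"
    using assms
    by (intro add_mono mult_left_mono abs_mult_div_sum_squares_le square_div_sum_squares_le) auto
  finally show ?thesis by simp
qed

text \<open>The coefficients of the logarithmic and arctangent terms in the partial fraction
  decomposition of the subtracted kernel.\<close>

definition log_coeff :: "real \<Rightarrow> real \<Rightarrow> real \<Rightarrow> real" where
  "log_coeff w v r = r * (r\<^sup>2 - w * v) / ((w\<^sup>2 + r\<^sup>2) * (v\<^sup>2 + r\<^sup>2))"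

definition arctan_coeff :: "real \<Rightarrow> real \<Rightarrow> real \<Rightarrow> real" where
  "arctan_coeff w v r = r\<^sup>2 * (w + v) / ((w\<^sup>2 + r\<^sup>2) * (v\<^sup>2 + r\<^sup>2))"

lemma log_coeff_commute: "log_coeff w v r = log_coeff v w r"
  by (simp add: log_coeff_def mult.commute)

lemma arctan_coeff_commute: "arctan_coeff w v r = arctan_coeff v w r"
  by (simp add: arctan_coeff_def mult.commute add.commute)

lemma measurable_log_coeff [measurable]: "log_coeff w v \<in> borel_measurable borel"
  unfolding log_coeff_def by measurable

lemma measurable_arctan_coeff [measurable]: "arctan_coeff w v \<in> borel_measurable borel"
  unfolding arctan_coeff_def by measurable

text \<open>In each product of the expansion the factor at \<open>v\<close> is at most 1 or 1/2, and
  the factor at \<open>w\<close> absorbs the weight 1 + r. Hence \<open>v = 0\<close> is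
  allowed.\<close>

lemma log_coeff_bound_aux:
  fixes w v r :: real
  assumes "w \<noteq> 0" "0 < r"
  shows "\<bar>log_coeff w v r\<bar> * (1 + r)
    \<le> 1 / (2 * \<bar>w\<bar>) + 1 + 1 / 2 * (\<bar>w\<bar> * (1 / w\<^sup>2 + 1 / (2 * \<bar>w\<bar>)))"
proof -
  have p: "w\<^sup>2 + r\<^sup>2 > 0" "v\<^sup>2 + r\<^sup>2 > 0"
    using assms by (simp_all add: sum_squares_pos)
  have "\<bar>r * (r\<^sup>2 - w * v)\<bar> \<le> r * r\<^sup>2 + r * (\<bar>w\<bar> * \<bar>v\<bar>)"
    using assms abs_triangle_ineq4[of "r\<^sup>2" "w * v"]
    by (simp add: abs_mult flip: distrib_left)
  then have "\<bar>log_coeff w v r\<bar> * (1 + r)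
      \<le> (r * r\<^sup>2 + r * (\<bar>w\<bar> * \<bar>v\<bar>)) / ((w\<^sup>2 + r\<^sup>2) * (v\<^sup>2 + r\<^sup>2)) * (1 + r)"
    using assms p unfolding log_coeff_def
    by (intro mult_right_mono) (auto simp: abs_mult divide_right_mono)
  also have "\<dots> = (r\<^sup>2 / (v\<^sup>2 + r\<^sup>2)) * (r / (w\<^sup>2 + r\<^sup>2) + r\<^sup>2 / (w\<^sup>2 + r\<^sup>2))
      + (\<bar>v * r\<bar> / (v\<^sup>2 + r\<^sup>2)) * (\<bar>w\<bar> * ((1 + r) / (w\<^sup>2 + r\<^sup>2)))"
    using p assms by (simp add: divide_simps abs_mult) (simp add: algebra_simps power2_eq_square)
  also have "\<dots> \<le> 1 * (1 / (2 * \<bar>w\<bar>) + 1) + 1 / 2 * (\<bar>w\<bar> * (1 / w\<^sup>2 + 1 / (2 * \<bar>w\<bar>)))"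
  proof -
    have "r / (w\<^sup>2 + r\<^sup>2) \<le> 1 / (2 * \<bar>w\<bar>)"
      using abs_mult_div_sum_squares_le[of w r] assms
      by (simp add: field_simps abs_mult sum_squares_pos)
    then show ?thesis
      using assms p
      by (intro add_mono mult_mono square_div_sum_squares_le weight_div_sum_squares_le
          abs_mult_div_sum_squares_le order_refl) auto
  qed
  finally show ?thesis by simp
qed

text \<open>Distinct points are not both 0, and by symmetry the nonzero one can be put first. At
  \<open>w = v = 0\<close> the coefficient would be 1/r, which admits no such bound.\<close>

lemma log_coeff_bound:
  assumes "w \<noteq> v"
  obtains C where "\<And>r. 0 < r \<Longrightarrow> \<bar>log_coeff w v r\<bar> * (1 + r) \<le> C"
proof (cases "w = 0")
  case True
  then have "v \<noteq> 0" using assms by simp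
  then show ?thesis
    using that log_coeff_bound_aux[of v _ w] by (metis log_coeff_commute)
next
  case False
  then show ?thesis
    using that log_coeff_bound_aux[of w _ v] by metis
qed

lemma arctan_coeff_bound_aux:
  fixes w v r :: real
  assumes "w \<noteq> 0" "0 < r"
  shows "\<bar>arctan_coeff w v r\<bar> * (1 + r) \<le> \<bar>w + v\<bar> * (1 / w\<^sup>2 + 1 / (2 * \<bar>w\<bar>))"
proof -
  have p: "w\<^sup>2 + r\<^sup>2 > 0" "v\<^sup>2 + r\<^sup>2 > 0"
    using assms by (simp_all add: sum_squares_pos)
  have "\<bar>arctan_coeff w v r\<bar> * (1 + r)
      = \<bar>w + v\<bar> * ((r\<^sup>2 / (v\<^sup>2 + r\<^sup>2)) * ((1 + r) / (w\<^sup>2 + r\<^sup>2)))"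
    using p assms by (simp add: arctan_coeff_def abs_mult mult_ac)
  also have "\<dots> \<le> \<bar>w + v\<bar> * (1 * (1 / w\<^sup>2 + 1 / (2 * \<bar>w\<bar>)))"
    using assms p
    by (intro mult_mono square_div_sum_squares_le weight_div_sum_squares_le) auto
  finally show ?thesis by simp
qed

lemma arctan_coeff_bound:
  assumes "w \<noteq> v"
  obtains C where "\<And>r. 0 < r \<Longrightarrow> \<bar>arctan_coeff w v r\<bar> * (1 + r) \<le> C"
proof (cases "w = 0")
  case True
  then have "v \<noteq> 0" using assms by simp
  then show ?thesis
    using that arctan_coeff_bound_aux[of v _ w] by (metis arctan_coeff_commute)
next
  case False
  then show ?thesis
    using that arctan_coeff_bound_aux[of w _ v] by metis
qed

section \<open>The subtracted kernel on a truncated line\<close>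

text \<open>The contribution of a single rate \<open>r\<close> to the divided difference, with the
  factor \<open>x - v\<close> cancelled. For r > 0 it is continuous at \<open>x = v\<close> \<noteq>
  \<open>w\<close>, where the uncancelled quotient has the default value 0.\<close>

definition subtracted_kernel :: "real \<Rightarrow> real \<Rightarrow> real \<Rightarrow> real \<Rightarrow> real" where
  "subtracted_kernel w v r x = r * (r\<^sup>2 - x * v) / ((x\<^sup>2 + r\<^sup>2) * (v\<^sup>2 + r\<^sup>2) * (x - w))"

lemma subtracted_kernel_eq:
  fixes w v r x :: real
  assumes "0 < r" "x \<noteq> v"
  shows "(x * r / (x\<^sup>2 + r\<^sup>2) - v * r / (v\<^sup>2 + r\<^sup>2)) / ((x - v) * (x - w)) = subtracted_kernel w v r x"
proof -
  have p: "x\<^sup>2 + r\<^sup>2 \<noteq> 0" "v\<^sup>2 + r\<^sup>2 \<noteq> 0"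
    using sum_squares_pos[OF assms(1)] by (metis less_irrefl)+
  have "x * r / (x\<^sup>2 + r\<^sup>2) - v * r / (v\<^sup>2 + r\<^sup>2)
      = (x - v) * (r * (r\<^sup>2 - x * v) / ((x\<^sup>2 + r\<^sup>2) * (v\<^sup>2 + r\<^sup>2)))"
    using p by (simp add: divide_simps) (simp add: algebra_simps power2_eq_square)
  then show ?thesis
    using assms by (simp add: subtracted_kernel_def)
qed

text \<open>Half of \<open>ln ((x - w)\<^sup>2)\<close> is ln |x - w|, so one formula serves on both
  sides of the pole.\<close>

definition kernel_primitive :: "real \<Rightarrow> real \<Rightarrow> real \<Rightarrow> real \<Rightarrow> real" where
  "kernel_primitive w v r x =
     log_coeff w v r / 2 * (ln ((x - w)\<^sup>2) - ln (x\<^sup>2 + r\<^sup>2)) - arctan_coeff w v r * arctan (x / r)"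

text \<open>\<open>log_coeff\<close> is the residue at the simple pole \<open>w\<close>. The kernel
  is O(1/x^2) at infinity, so x/(x^2 + r^2) must carry the opposite coefficient.\<close>

lemma kernel_partial_fractions:
  fixes w v r x :: real
  assumes "0 < r" "x \<noteq> w"
  shows "subtracted_kernel w v r x
    = log_coeff w v r * (1 / (x - w) - x / (x\<^sup>2 + r\<^sup>2)) - arctan_coeff w v r * (r / (x\<^sup>2 + r\<^sup>2))"
proof -
  have p: "x\<^sup>2 + r\<^sup>2 \<noteq> 0" "v\<^sup>2 + r\<^sup>2 \<noteq> 0" "w\<^sup>2 + r\<^sup>2 \<noteq> 0" "x - w \<noteq> 0"
    using sum_squares_pos[OF assms(1)] assms(2) by (metis less_irrefl eq_iff_diff_eq_0)+
  then show ?thesis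
    unfolding subtracted_kernel_def log_coeff_def arctan_coeff_def
    by (simp add: divide_simps) (simp add: algebra_simps power2_eq_square)
qed

lemma DERIV_arctan_scaled:
  fixes r x :: real
  assumes "0 < r"
  shows "((\<lambda>x. arctan (x / r)) has_real_derivative r / (x\<^sup>2 + r\<^sup>2)) (at x)"
proof -
  have "1 + (x / r)\<^sup>2 = (x\<^sup>2 + r\<^sup>2) / r\<^sup>2"
    using assms by (simp add: power_divide add_divide_distrib)
  then have "inverse (1 + (x / r)\<^sup>2) / r = r / (x\<^sup>2 + r\<^sup>2)"
    using assms by (simp add: power2_eq_square)
  then show ?thesis
    using assms by (auto intro!: derivative_eq_intros)
qed

lemma kernel_primitive_deriv:
  fixes w v r x :: real
  assumes "0 < r" "x \<noteq> w"
  shows "(kernel_primitive w v r has_real_derivative subtracted_kernel w v r x) (at x)"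
proof -
  have "2 * d / d\<^sup>2 = 2 * (1 / d)" for d :: real
    by (simp add: power2_eq_square)
  from this[of "x - w"] have "((\<lambda>x. ln ((x - w)\<^sup>2)) has_real_derivative 2 * (1 / (x - w))) (at x)"
    using assms by (auto intro!: derivative_eq_intros)
  moreover have "((\<lambda>x. ln (x\<^sup>2 + r\<^sup>2)) has_real_derivative 2 * (x / (x\<^sup>2 + r\<^sup>2))) (at x)"
    using assms by (auto intro!: derivative_eq_intros simp: sum_squares_pos)
  ultimately have "(kernel_primitive w v r has_real_derivative
      log_coeff w v r / 2 * (2 * (1 / (x - w)) - 2 * (x / (x\<^sup>2 + r\<^sup>2)))
        - arctan_coeff w v r * (r / (x\<^sup>2 + r\<^sup>2))) (at x)"
    unfolding kernel_primitive_def[abs_def]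
    by (intro DERIV_diff DERIV_cmult DERIV_arctan_scaled assms)
  moreover have "log_coeff w v r / 2 * (2 * (1 / (x - w)) - 2 * (x / (x\<^sup>2 + r\<^sup>2)))
      = log_coeff w v r * (1 / (x - w) - x / (x\<^sup>2 + r\<^sup>2))"
    unfolding right_diff_distrib[symmetric] by simp
  ultimately show ?thesis
    by (simp only: kernel_partial_fractions[OF assms])
qed

lemma continuous_on_subtracted_kernel:
  assumes "0 < r" "w \<notin> S"
  shows "continuous_on S (subtracted_kernel w v r)"
proof -
  have "x\<^sup>2 + r\<^sup>2 \<noteq> 0" for x
    using sum_squares_pos[OF assms(1)] by (metis less_irrefl)
  then show ?thesis
    using assms unfolding subtracted_kernel_def by (intro continuous_intros) auto
qed

lemma measurable_subtracted_kernel [measurable]: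
  "(\<lambda>(r, x). subtracted_kernel w v r x) \<in> borel_measurable (borel \<Otimes>\<^sub>M borel)"
  unfolding subtracted_kernel_def by measurable

text \<open>In the symmetric excision around \<open>w\<close> the singular logarithms \<open>ln (e\<^sup>2)\<close> cancel, so that the
  truncation parameters \<open>R\<close> and \<open>e\<close> separate.\<close>

definition outer_part :: "real \<Rightarrow> real \<Rightarrow> real \<Rightarrow> real \<Rightarrow> real" where
  "outer_part w v R r = log_coeff w v r * ((ln ((R - w)\<^sup>2) - ln ((R + w)\<^sup>2)) / 2)
     - 2 * (arctan_coeff w v r * arctan (R / r))"

definition inner_part :: "real \<Rightarrow> real \<Rightarrow> real \<Rightarrow> real \<Rightarrow> real" where
  "inner_part w v e r = log_coeff w v r * ((ln ((w + e)\<^sup>2 + r\<^sup>2) - ln ((w - e)\<^sup>2 + r\<^sup>2)) / 2)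
     + arctan_coeff w v r * (arctan ((w + e) / r) - arctan ((w - e) / r))"

lemma measurable_outer_part [measurable]: "outer_part w v R \<in> borel_measurable borel"
  unfolding outer_part_def by measurable

lemma measurable_inner_part [measurable]: "inner_part w v e \<in> borel_measurable borel"
  unfolding inner_part_def by measurable

text \<open>The condition \<open>\<bar>w\<bar> + e < R\<close> puts the excised interval inside the
  truncated line, leaving two intervals that avoid \<open>w\<close>; the fundamental theorem of
  calculus applies on each.\<close>

lemma truncated_kernel_integral:
  assumes "0 < r" "0 < e" "\<bar>w\<bar> + e < R"
  shows "(LINT x:({-R..R} - {w-e<..<w+e})|lborel. subtracted_kernel w v r x)
    = outer_part w v R r + inner_part w v e r"
proof -
  have FTC: "set_integrable lborel {a..b} (subtracted_kernel w v r)"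
      "(LINT x:{a..b}|lborel. subtracted_kernel w v r x)
        = kernel_primitive w v r b - kernel_primitive w v r a"
    if "a \<le> b" "w \<notin> {a..b}" for a b
  proof -
    have "has_bochner_integral lborel (\<lambda>x. indicator {a..b} x *\<^sub>R subtracted_kernel w v r x)
        (kernel_primitive w v r b - kernel_primitive w v r a)"
    proof (rule has_bochner_integral_FTC_Icc)
      show "(kernel_primitive w v r has_vector_derivative subtracted_kernel w v r x) (at x within {a..b})"
        if "a \<le> x" "x \<le> b" for x
        using kernel_primitive_deriv[of r x w v] assms \<open>w \<notin> _\<close> that
        by (auto simp flip: has_real_derivative_iff_has_vector_derivative intro: DERIV_subset)
      show "continuous_on {a..b} (subtracted_kernel w v r)"
        by (rule continuous_on_subtracted_kernel) (use assms that in auto)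
    qed (use that in auto)
    then show "set_integrable lborel {a..b} (subtracted_kernel w v r)"
        "(LINT x:{a..b}|lborel. subtracted_kernel w v r x)
        = kernel_primitive w v r b - kernel_primitive w v r a"
      unfolding set_integrable_def set_lebesgue_integral_def
      by (simp_all add: has_bochner_integral_iff)
  qed
  have "{-R..R} - {w-e<..<w+e} = {-R..w-e} \<union> {w+e..R}"
    using assms by auto
  then have "(LINT x:({-R..R} - {w-e<..<w+e})|lborel. subtracted_kernel w v r x)
      = (LINT x:{-R..w-e}|lborel. subtracted_kernel w v r x)
        + (LINT x:{w+e..R}|lborel. subtracted_kernel w v r x)"
    using assms by (subst set_integral_Un[symmetric]) (auto intro!: FTC)
  also have "\<dots> = (kernel_primitive w v r (w - e) - kernel_primitive w v r (- R))
      + (kernel_primitive w v r R - kernel_primitive w v r (w + e))"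
    using assms by (subst (1 2) FTC) auto
  also have "\<dots> = outer_part w v R r + inner_part w v e r"
  proof -
    \<comment> \<open>Between the outer ends ln (R^2 + r^2) cancels, and the odd arctangent
      doubles.\<close>
    have "(- R - w)\<^sup>2 = (R + w)\<^sup>2"
      by (simp add: power2_eq_square algebra_simps)
    then show ?thesis
      by (simp add: kernel_primitive_def outer_part_def inner_part_def arctan_minus)
        (simp add: algebra_simps add_divide_distrib diff_divide_distrib)
  qed
  finally show ?thesis .
qed

section \<open>Majorants for the exchange of integrals\<close>

text \<open>The Lorentzian r/(x^2 + r^2) peaks like 1/r at x = 0, so it has no bound by a multiple
  of 1/(1 + r) uniform in \<open>x\<close>; it is kept because its integral over \<open>x\<close>
  has one. The rest already decays like 1/(1 + r).\<close>

lemma subtracted_kernel_bound: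
  fixes w v r x e :: real
  assumes "0 < r" "0 < e" "e \<le> \<bar>x - w\<bar>"
  shows "\<bar>subtracted_kernel w v r x\<bar>
    \<le> (r / (x\<^sup>2 + r\<^sup>2) + \<bar>v\<bar> * (1 / v\<^sup>2 + 1 / (2 * \<bar>v\<bar>)) / (1 + r)) / e"
proof -
  have p: "x\<^sup>2 + r\<^sup>2 > 0" "v\<^sup>2 + r\<^sup>2 > 0"
    using assms by (simp_all add: sum_squares_pos)
  have q: "\<bar>v\<bar> / (v\<^sup>2 + r\<^sup>2) \<le> \<bar>v\<bar> * (1 / v\<^sup>2 + 1 / (2 * \<bar>v\<bar>)) / (1 + r)"
  proof (cases "v = 0")
    case False
    have "\<bar>v\<bar> * ((1 + r) / (v\<^sup>2 + r\<^sup>2)) \<le> \<bar>v\<bar> * (1 / v\<^sup>2 + 1 / (2 * \<bar>v\<bar>))"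
      using False assms by (intro mult_left_mono weight_div_sum_squares_le) auto
    then show ?thesis
      using assms by (simp add: pos_le_divide_eq)
  qed simp
  \<comment> \<open>Splitting r^2 - x v pairs each factor in \<open>x\<close> with one in
    \<open>v\<close>, so that \<open>q\<close> controls the second product.\<close>
  have "subtracted_kernel w v r x
      = (r / (x\<^sup>2 + r\<^sup>2) * (r\<^sup>2 / (v\<^sup>2 + r\<^sup>2)) - x * r / (x\<^sup>2 + r\<^sup>2) * (v / (v\<^sup>2 + r\<^sup>2))) / (x - w)"
    using p assms unfolding subtracted_kernel_def
    by (simp add: divide_simps) (simp add: algebra_simps power2_eq_square)
  then have "\<bar>subtracted_kernel w v r x\<bar>
      \<le> (\<bar>r / (x\<^sup>2 + r\<^sup>2) * (r\<^sup>2 / (v\<^sup>2 + r\<^sup>2))\<bar> + \<bar>x * r / (x\<^sup>2 + r\<^sup>2) * (v / (v\<^sup>2 + r\<^sup>2))\<bar>) / \<bar>x - w\<bar>"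
    by (simp only: abs_divide) (intro divide_right_mono abs_triangle_ineq4 abs_ge_zero)
  also have "\<dots> \<le> (\<bar>r / (x\<^sup>2 + r\<^sup>2) * (r\<^sup>2 / (v\<^sup>2 + r\<^sup>2))\<bar> + \<bar>x * r / (x\<^sup>2 + r\<^sup>2) * (v / (v\<^sup>2 + r\<^sup>2))\<bar>) / e"
    using assms by (intro divide_left_mono) auto
  also have "\<dots> = (r / (x\<^sup>2 + r\<^sup>2) * (r\<^sup>2 / (v\<^sup>2 + r\<^sup>2)) + \<bar>x * r\<bar> / (x\<^sup>2 + r\<^sup>2) * (\<bar>v\<bar> / (v\<^sup>2 + r\<^sup>2))) / e"
    using assms p by (simp add: abs_mult)
  also have "\<dots> \<le> (r / (x\<^sup>2 + r\<^sup>2) * 1 + 1 / 2 * (\<bar>v\<bar> * (1 / v\<^sup>2 + 1 / (2 * \<bar>v\<bar>)) / (1 + r))) / e"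
    using assms p
    by (intro divide_right_mono add_mono mult_mono square_div_sum_squares_le
        abs_mult_div_sum_squares_le order_refl q) auto
  also have "\<dots> \<le> (r / (x\<^sup>2 + r\<^sup>2) * 1 + 1 * (\<bar>v\<bar> * (1 / v\<^sup>2 + 1 / (2 * \<bar>v\<bar>)) / (1 + r))) / e"
    using assms by (intro divide_right_mono add_mono mult_mono) auto
  finally show ?thesis by simp
qed

text \<open>The constant \<open>c\<close> stands for the part of the preceding majorant that does
  not depend on \<open>x\<close>.\<close>

lemma integral_lorentzian:
  fixes r R c :: real
  assumes "0 < r" "0 \<le> R"
  shows "has_bochner_integral lborel (\<lambda>x. indicator {-R..R} x *\<^sub>R (r / (x\<^sup>2 + r\<^sup>2) + c))
    (2 * arctan (R / r) + 2 * R * c)"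
proof -
  have p: "x\<^sup>2 + r\<^sup>2 \<noteq> 0" for x
    using sum_squares_pos[OF assms(1)] by (metis less_irrefl)
  have "has_bochner_integral lborel (\<lambda>x. indicator {-R..R} x *\<^sub>R (r / (x\<^sup>2 + r\<^sup>2) + c))
      ((arctan (R / r) + R * c) - (arctan ((- R) / r) + (- R) * c))"
  proof (rule has_bochner_integral_FTC_Icc)
    show "((\<lambda>x. arctan (x / r) + x * c) has_vector_derivative r / (x\<^sup>2 + r\<^sup>2) + c) (at x within {-R..R})" for x
      unfolding has_real_derivative_iff_has_vector_derivative[symmetric]
      using DERIV_add[OF DERIV_arctan_scaled[OF assms(1)] DERIV_cmult_right[OF DERIV_ident, of c]]
      by (auto intro: DERIV_subset)
    show "continuous_on {-R..R} (\<lambda>x. r / (x\<^sup>2 + r\<^sup>2) + c)"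
      using p by (intro continuous_intros) auto
  qed (use assms in auto)
  then show ?thesis
    by (simp add: arctan_minus algebra_simps)
qed

lemma abs_mult_arctan_le: "\<bar>c * arctan x\<bar> \<le> \<bar>c\<bar> * (pi / 2)"
proof -
  have "\<bar>arctan x\<bar> \<le> pi / 2"
    using arctan_bounded[of x] by linarith
  then show ?thesis
    unfolding abs_mult by (intro mult_left_mono) auto
qed

text \<open>The bound pi/2 on the arctangent pays for the summand 1 of the weight, and arctan y
  \<le> y for the summand \<open>r\<close>.\<close>

lemma arctan_ratio_bound:
  fixes r R :: real
  assumes "0 < r" "0 \<le> R"
  shows "2 * arctan (R / r) * (1 + r) \<le> pi + 2 * R"
proof -
  have "arctan (R / r) \<le> R / r"
    using assms by (intro arctan_le_self) simp
  then have "r * arctan (R / r) \<le> R"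
    using assms by (simp add: field_simps)
  moreover have "2 * arctan (R / r) \<le> pi"
    using arctan_bounded[of "R / r"] by simp
  ultimately show ?thesis
    by (simp add: algebra_simps)
qed

section \<open>Superposition over the spectral measure\<close>

text \<open>Sigma-finiteness serves Fubini's theorem; positivity almost everywhere lets integrals
  over \<open>{0<..}\<close> be written over the whole line.\<close>

locale spectral_measure = sigma_finite_measure \<nu> for \<nu> :: "real measure" +
  assumes sets_eq [measurable_cong]: "sets \<nu> = sets borel"
    and AE_pos: "AE r in \<nu>. 0 < r"
    and integrable_weight: "integrable \<nu> (\<lambda>r. 1 / (1 + r))"
begin

text \<open>Comparison with a multiple of 1/(1 + r). The bound is stated as a product to match the
  kernel bounds above.\<close>

lemma integrable_weightI:
  fixes g :: "real \<Rightarrow> 'b::{banach, second_countable_topology}"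
  assumes [measurable]: "g \<in> borel_measurable borel"
    and "\<And>r. 0 < r \<Longrightarrow> norm (g r) * (1 + r) \<le> C"
  shows "integrable \<nu> g"
proof (rule Bochner_Integration.integrable_bound)
  show "integrable \<nu> (\<lambda>r. C * (1 / (1 + r)))"
    by (rule integrable_mult_right[OF integrable_weight])
  show "AE r in \<nu>. norm (g r) \<le> norm (C * (1 / (1 + r)))"
    using AE_pos
  proof eventually_elim
    case (elim r)
    then show ?case
      using assms(2)[of r] by (simp add: pos_le_divide_eq abs_mult)
  qed
qed measurable

lemma set_integral_pos:
  fixes g :: "real \<Rightarrow> 'b::{banach, second_countable_topology}"
  assumes [measurable]: "g \<in> borel_measurable borel"
  shows "(LINT r:{0<..}|\<nu>. g r) = (LINT r|\<nu>. g r)"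
  unfolding set_lebesgue_integral_def
proof (rule integral_cong_AE)
  show "AE r in \<nu>. indicator {0<..} r *\<^sub>R g r = g r"
    using AE_pos by eventually_elim simp
qed measurable

lemma integrable_dispersion_kernel: "integrable \<nu> (\<lambda>r. x * r / (x\<^sup>2 + r\<^sup>2))"
  by (rule integrable_weightI[of _ "1 / 2 + \<bar>x\<bar>"]) (measurable, metis real_norm_def dispersion_kernel_bound)

lemma integrable_log_coeff: "w \<noteq> v \<Longrightarrow> integrable \<nu> (log_coeff w v)"
  by (rule log_coeff_bound[of w v]) (auto intro!: integrable_weightI)

lemma integrable_arctan_coeff: "w \<noteq> v \<Longrightarrow> integrable \<nu> (arctan_coeff w v)"
  by (rule arctan_coeff_bound[of w v]) (auto intro!: integrable_weightI)

section \<open>Attenuation and dispersion as spectral integrals\<close>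

text \<open>Expand -ix/(r - ix) by r + ix. Integrability of the complex integrand is what allows
  real and imaginary parts to be taken under the integral.\<close>

lemma beta_imaginary_axis:
  "beta \<nu> (- \<i> * complex_of_real x)
    = (LINT r|\<nu>. Complex (x\<^sup>2 / (x\<^sup>2 + r\<^sup>2)) (- (x * r / (x\<^sup>2 + r\<^sup>2))))"
  "x \<noteq> 0 \<Longrightarrow> integrable \<nu> (\<lambda>r. Complex (x\<^sup>2 / (x\<^sup>2 + r\<^sup>2)) (- (x * r / (x\<^sup>2 + r\<^sup>2))))"
proof -
  have eq: "- \<i> * complex_of_real x * (1 / (- \<i> * complex_of_real x + complex_of_real r))
      = Complex (x\<^sup>2 / (x\<^sup>2 + r\<^sup>2)) (- (x * r / (x\<^sup>2 + r\<^sup>2)))" for r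
    by (rule complex_eqI) (simp_all add: Re_divide Im_divide power2_eq_square add.commute)
  show "beta \<nu> (- \<i> * complex_of_real x)
    = (LINT r|\<nu>. Complex (x\<^sup>2 / (x\<^sup>2 + r\<^sup>2)) (- (x * r / (x\<^sup>2 + r\<^sup>2))))"
    unfolding beta_def eq[symmetric]
    by (subst set_integral_pos) (measurable, rule integral_mult_right_zero[symmetric])
  assume "x \<noteq> 0"
  show "integrable \<nu> (\<lambda>r. Complex (x\<^sup>2 / (x\<^sup>2 + r\<^sup>2)) (- (x * r / (x\<^sup>2 + r\<^sup>2))))"
  proof (rule integrable_weightI)
    show "(\<lambda>r. Complex (x\<^sup>2 / (x\<^sup>2 + r\<^sup>2)) (- (x * r / (x\<^sup>2 + r\<^sup>2)))) \<in> borel_measurable borel"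
      unfolding eq[symmetric] by measurable
    fix r :: real assume r: "0 < r"
    have "norm (Complex (x\<^sup>2 / (x\<^sup>2 + r\<^sup>2)) (- (x * r / (x\<^sup>2 + r\<^sup>2))))
        \<le> \<bar>x\<^sup>2 / (x\<^sup>2 + r\<^sup>2)\<bar> + \<bar>x * r / (x\<^sup>2 + r\<^sup>2)\<bar>"
      using cmod_le[of "Complex (x\<^sup>2 / (x\<^sup>2 + r\<^sup>2)) (- (x * r / (x\<^sup>2 + r\<^sup>2)))"] by simp
    then have "norm (Complex (x\<^sup>2 / (x\<^sup>2 + r\<^sup>2)) (- (x * r / (x\<^sup>2 + r\<^sup>2)))) * (1 + r)
        \<le> (\<bar>x\<^sup>2 / (x\<^sup>2 + r\<^sup>2)\<bar> + \<bar>x * r / (x\<^sup>2 + r\<^sup>2)\<bar>) * (1 + r)"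
      using r by (intro mult_right_mono) auto
    also have "\<dots> = x\<^sup>2 * ((1 + r) / (x\<^sup>2 + r\<^sup>2)) + \<bar>x * r / (x\<^sup>2 + r\<^sup>2)\<bar> * (1 + r)"
      using r by (simp add: distrib_right)
    also have "\<dots> \<le> x\<^sup>2 * (1 / x\<^sup>2 + 1 / (2 * \<bar>x\<bar>)) + (1 / 2 + \<bar>x\<bar>)"
      using \<open>x \<noteq> 0\<close> r
      by (intro add_mono mult_left_mono weight_div_sum_squares_le dispersion_kernel_bound) auto
    finally show "norm (Complex (x\<^sup>2 / (x\<^sup>2 + r\<^sup>2)) (- (x * r / (x\<^sup>2 + r\<^sup>2)))) * (1 + r)
        \<le> x\<^sup>2 * (1 / x\<^sup>2 + 1 / (2 * \<bar>x\<bar>)) + (1 / 2 + \<bar>x\<bar>)" .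
  qed
qed

lemma integrable_attenuation_kernel: "integrable \<nu> (\<lambda>r. x\<^sup>2 / (x\<^sup>2 + r\<^sup>2))"
  using integrable_Re[OF beta_imaginary_axis(2)[of x]] by (cases "x = 0") simp_all

lemma attenuation_eq: "attenuation \<nu> x = (LINT r|\<nu>. x\<^sup>2 / (x\<^sup>2 + r\<^sup>2))"
proof (cases "x = 0")
  case True
  then show ?thesis by (simp add: attenuation_def beta_def)
next
  case False
  then show ?thesis
    unfolding attenuation_def beta_imaginary_axis
    using integral_Re[OF beta_imaginary_axis(2)[of x]] by simp
qed

lemma dispersion_eq: "dispersion \<nu> x = (LINT r|\<nu>. x * r / (x\<^sup>2 + r\<^sup>2))"
proof (cases "x = 0")
  case True
  then show ?thesis by (simp add: dispersion_def beta_def)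
next
  case False
  then show ?thesis
    unfolding dispersion_def beta_imaginary_axis
    using integral_Im[OF beta_imaginary_axis(2)[of x]] by simp
qed

text \<open>The numerators combine to r^2 (w^2 - v^2), and w^2 - v^2 = (w - v)(w + v). So the
  integral of \<open>arctan_coeff\<close> is what the principal value has to produce.\<close>

lemma attenuation_diff:
  assumes "w \<noteq> v"
  shows "attenuation \<nu> w - attenuation \<nu> v = (w - v) * (LINT r|\<nu>. arctan_coeff w v r)"
proof -
  have "attenuation \<nu> w - attenuation \<nu> v = (LINT r|\<nu>. w\<^sup>2 / (w\<^sup>2 + r\<^sup>2) - v\<^sup>2 / (v\<^sup>2 + r\<^sup>2))"
    by (simp add: attenuation_eq integrable_attenuation_kernel)
  also have "\<dots> = (LINT r|\<nu>. (w - v) * arctan_coeff w v r)"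
  proof (rule integral_cong_AE)
    show "AE r in \<nu>. w\<^sup>2 / (w\<^sup>2 + r\<^sup>2) - v\<^sup>2 / (v\<^sup>2 + r\<^sup>2) = (w - v) * arctan_coeff w v r"
      using AE_pos
    proof eventually_elim
      case (elim r)
      have "w\<^sup>2 + r\<^sup>2 \<noteq> 0" "v\<^sup>2 + r\<^sup>2 \<noteq> 0"
        using sum_squares_pos[OF elim] by (metis less_irrefl)+
      then show ?case
        unfolding arctan_coeff_def
        by (simp add: divide_simps) (simp add: algebra_simps power2_eq_square)
    qed
  qed measurable
  finally show ?thesis by simp
qed

lemma divided_difference_eq:
  assumes "x \<noteq> v"
  shows "(dispersion \<nu> x - dispersion \<nu> v) / ((x - v) * (x - w)) = (LINT r|\<nu>. subtracted_kernel w v r x)"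
proof -
  have "(dispersion \<nu> x - dispersion \<nu> v) / ((x - v) * (x - w))
      = (LINT r|\<nu>. (x * r / (x\<^sup>2 + r\<^sup>2) - v * r / (v\<^sup>2 + r\<^sup>2)) / ((x - v) * (x - w)))"
    by (simp add: dispersion_eq integrable_dispersion_kernel)
  also have "\<dots> = (LINT r|\<nu>. subtracted_kernel w v r x)"
  proof (rule integral_cong_AE)
    show "AE r in \<nu>. (x * r / (x\<^sup>2 + r\<^sup>2) - v * r / (v\<^sup>2 + r\<^sup>2)) / ((x - v) * (x - w))
        = subtracted_kernel w v r x"
      using AE_pos by eventually_elim (rule subtracted_kernel_eq[OF _ assms])
  qed measurable
  finally show ?thesis .
qed

section \<open>Exchanging the frequency and the spectral integral\<close>

text \<open>The excision keeps |x - w| \<ge> e, so \<open>subtracted_kernel_bound\<close> applies.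
  Integrating its majorant over \<open>x\<close> first leaves a function of \<open>r\<close> bounded
  by a multiple of 1/(1 + r), which is integrable over \<open>\<nu>\<close>.\<close>

lemma integrable_pair_kernel:
  fixes w v e R :: real
  assumes "0 < e" "0 \<le> R"
  shows "integrable (\<nu> \<Otimes>\<^sub>M lborel)
    (\<lambda>(r, x). indicator ({-R..R} - {w-e<..<w+e}) x *\<^sub>R subtracted_kernel w v r x)"
    (is "integrable _ (\<lambda>(r, x). ?f r x)")
proof -
  interpret pair_sigma_finite \<nu> lborel ..
  \<comment> \<open>The \<open>v\<close>-dependent constant of
    \<open>subtracted_kernel_bound\<close>.\<close>
  define K where "K = \<bar>v\<bar> * (1 / v\<^sup>2 + 1 / (2 * \<bar>v\<bar>))"
  have meas [measurable]: "(\<lambda>(r, x). ?f r x) \<in> borel_measurable (\<nu> \<Otimes>\<^sub>M lborel)"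
    by measurable
  have bound: "norm (?f r x) \<le> norm (indicator {-R..R} x *\<^sub>R (r / (x\<^sup>2 + r\<^sup>2) + K / (1 + r)) / e)"
    if "0 < r" for r x
  proof (cases "x \<in> {-R..R} - {w-e<..<w+e}")
    case True
    then have "e \<le> \<bar>x - w\<bar>" by auto
    from subtracted_kernel_bound[OF that assms(1) this, of v]
    have "norm (?f r x) \<le> indicator {-R..R} x *\<^sub>R (r / (x\<^sup>2 + r\<^sup>2) + K / (1 + r)) / e"
      using True by (simp add: K_def)
    then show ?thesis
      unfolding real_norm_def by (rule order_trans[OF _ abs_ge_self])
  qed simp
  have dom: "has_bochner_integral lborel
      (\<lambda>x. indicator {-R..R} x *\<^sub>R (r / (x\<^sup>2 + r\<^sup>2) + K / (1 + r)) / e)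
      ((2 * arctan (R / r) + 2 * R * (K / (1 + r))) / e)" if "0 < r" for r
    by (intro has_bochner_integral_divide integral_lorentzian that assms)
  have int: "integrable lborel (?f r)" if "0 < r" for r
  proof (rule Bochner_Integration.integrable_bound)
    show "integrable lborel (\<lambda>x. indicator {-R..R} x *\<^sub>R (r / (x\<^sup>2 + r\<^sup>2) + K / (1 + r)) / e)"
      using dom[OF that] unfolding has_bochner_integral_iff by blast
  qed (use bound[OF that] in auto)
  have "0 \<le> K"
    by (simp add: K_def)
  show ?thesis
  proof (rule Fubini_integrable)
    show "AE r in \<nu>. integrable lborel (\<lambda>x. case (r, x) of (r, x) \<Rightarrow> ?f r x)"
      using AE_pos by eventually_elim (unfold prod.case, rule int)
    have "integrable \<nu> (\<lambda>r. (LINT x|lborel. norm (?f r x)))"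
    proof (rule integrable_weightI)
      show "(\<lambda>r. (LINT x|lborel. norm (?f r x))) \<in> borel_measurable borel"
        by measurable
      fix r :: real assume r: "0 < r"
      have "(LINT x|lborel. norm (?f r x))
          \<le> (LINT x|lborel. indicator {-R..R} x *\<^sub>R (r / (x\<^sup>2 + r\<^sup>2) + K / (1 + r)) / e)"
      proof (rule integral_mono)
        fix x
        have "0 \<le> indicator {-R..R} x *\<^sub>R (r / (x\<^sup>2 + r\<^sup>2) + K / (1 + r)) / e"
          using r assms \<open>0 \<le> K\<close> by (auto simp: indicator_def)
        with bound[OF r, of x]
        show "norm (?f r x) \<le> indicator {-R..R} x *\<^sub>R (r / (x\<^sup>2 + r\<^sup>2) + K / (1 + r)) / e"
          by simp
      qed (use int[OF r] dom[OF r] in \<open>auto simp: has_bochner_integral_iff\<close>)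
      also have "\<dots> = (2 * arctan (R / r) + 2 * R * (K / (1 + r))) / e"
        using dom[OF r] by (rule has_bochner_integral_integral_eq)
      finally have "(LINT x|lborel. norm (?f r x)) * (1 + r)
          \<le> (2 * arctan (R / r) + 2 * R * (K / (1 + r))) / e * (1 + r)"
        using r by (intro mult_right_mono) auto
      also have "\<dots> = (2 * arctan (R / r) * (1 + r) + 2 * R * K) / e"
        using r by (simp add: distrib_right)
      also have "\<dots> \<le> (pi + 2 * R + 2 * R * K) / e"
        using r assms arctan_ratio_bound[of r R] by (intro divide_right_mono add_right_mono) auto
      finally show "norm (LINT x|lborel. norm (?f r x)) * (1 + r) \<le> (pi + 2 * R + 2 * R * K) / e"
        by simp
    qed
    then show "integrable \<nu> (\<lambda>r. (LINT x|lborel. norm (case (r, x) of (r, x) \<Rightarrow> ?f r x)))"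
      by simp
  qed (fact meas)
qed

lemma measurable_dispersion [measurable]: "dispersion \<nu> \<in> borel_measurable borel"
  unfolding dispersion_eq[abs_def] by measurable

lemma truncated_divided_difference:
  fixes w v e R :: real
  assumes "0 < e" "0 \<le> R"
  defines "T \<equiv> {-R..R} - {w-e<..<w+e}"
  shows "set_integrable lborel T (\<lambda>x. (dispersion \<nu> x - dispersion \<nu> v) / ((x - v) * (x - w)))"
    and "(LINT x:T|lborel. (dispersion \<nu> x - dispersion \<nu> v) / ((x - v) * (x - w)))
      = (LINT r|\<nu>. (LINT x:T|lborel. subtracted_kernel w v r x))"
proof -
  interpret pair_sigma_finite \<nu> lborel ..
  have int: "integrable (\<nu> \<Otimes>\<^sub>M lborel) (\<lambda>(r, x). indicator T x *\<^sub>R subtracted_kernel w v r x)"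
    unfolding T_def by (rule integrable_pair_kernel[OF assms(1,2)])
  have [measurable]: "T \<in> sets borel"
    by (simp add: T_def)
  \<comment> \<open>Only at the null set \<open>x = v\<close> can the quotient differ from the
    integral of the cancelled kernel.\<close>
  have ae: "AE x in lborel. indicator T x *\<^sub>R ((dispersion \<nu> x - dispersion \<nu> v) / ((x - v) * (x - w)))
      = (LINT r|\<nu>. indicator T x *\<^sub>R subtracted_kernel w v r x)"
    using AE_lborel_singleton[of v] by eventually_elim (simp add: divided_difference_eq)
  have "integrable lborel (\<lambda>x. LINT r|\<nu>. indicator T x *\<^sub>R subtracted_kernel w v r x)"
    using integrable_snd[OF int] .
  then show "set_integrable lborel T (\<lambda>x. (dispersion \<nu> x - dispersion \<nu> v) / ((x - v) * (x - w)))"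
    unfolding set_integrable_def
    by (subst integrable_cong_AE[OF _ _ ae]) measurable
  have "(LINT x:T|lborel. (dispersion \<nu> x - dispersion \<nu> v) / ((x - v) * (x - w)))
      = (LINT x|lborel. LINT r|\<nu>. indicator T x *\<^sub>R subtracted_kernel w v r x)"
    unfolding set_lebesgue_integral_def
    by (rule integral_cong_AE[OF _ _ ae]) measurable
  then show "(LINT x:T|lborel. (dispersion \<nu> x - dispersion \<nu> v) / ((x - v) * (x - w)))
      = (LINT r|\<nu>. (LINT x:T|lborel. subtracted_kernel w v r x))"
    unfolding set_lebesgue_integral_def by (simp only: Fubini_integral[OF int])
qed

section \<open>Limits of the outer and inner parts\<close>

lemma integrable_arctan_coeff_arctan:
  assumes "w \<noteq> v"
  shows "integrable \<nu> (\<lambda>r. arctan_coeff w v r * arctan (R / r))"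
proof (rule Bochner_Integration.integrable_bound)
  show "integrable \<nu> (\<lambda>r. \<bar>arctan_coeff w v r\<bar> * (pi / 2))"
    using integrable_arctan_coeff[OF assms] by simp
  show "AE r in \<nu>. norm (arctan_coeff w v r * arctan (R / r)) \<le> norm (\<bar>arctan_coeff w v r\<bar> * (pi / 2))"
    using order_trans[OF abs_mult_arctan_le abs_ge_self] by (simp only: real_norm_def) simp
qed measurable

lemma integrable_outer_part: "w \<noteq> v \<Longrightarrow> integrable \<nu> (outer_part w v R)"
  unfolding outer_part_def
  using integrable_log_coeff integrable_arctan_coeff_arctan by auto

text \<open>By the symmetric truncation the logarithmic factor is free of \<open>r\<close>; it comes
  out of the integral and tends to 0. In the other term arctan (R/r) tends to pi/2 for each r > 0,
  dominated by \<open>arctan_coeff\<close> times pi/2, and the factor 2 gives pi.\<close>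

lemma integral_outer_part_tendsto:
  assumes "w \<noteq> v"
  shows "((\<lambda>R. LINT r|\<nu>. outer_part w v R r) \<longlongrightarrow> - (pi * (LINT r|\<nu>. arctan_coeff w v r))) at_top"
proof -
  have eq: "(LINT r|\<nu>. outer_part w v R r)
      = (LINT r|\<nu>. log_coeff w v r) * ((ln ((R - w)\<^sup>2) - ln ((R + w)\<^sup>2)) / 2)
        - 2 * (LINT r|\<nu>. arctan_coeff w v r * arctan (R / r))" for R
    unfolding outer_part_def
    using integrable_log_coeff[OF assms] integrable_arctan_coeff_arctan[OF assms, of R] by simp
  have "((\<lambda>R. (ln ((R - w)\<^sup>2) - ln ((R + w)\<^sup>2)) / 2) \<longlongrightarrow> 0) at_top"
    by real_asymp
  then have log: "((\<lambda>R. (LINT r|\<nu>. log_coeff w v r) * ((ln ((R - w)\<^sup>2) - ln ((R + w)\<^sup>2)) / 2))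
      \<longlongrightarrow> (LINT r|\<nu>. log_coeff w v r) * 0) at_top"
    by (rule tendsto_mult_left)
  have "((\<lambda>R. LINT r|\<nu>. arctan_coeff w v r * arctan (R / r))
      \<longlongrightarrow> (LINT r|\<nu>. arctan_coeff w v r * (pi / 2))) at_top"
  proof (rule integral_dominated_convergence_at_top)
    show "integrable \<nu> (\<lambda>r. \<bar>arctan_coeff w v r\<bar> * (pi / 2))"
      using integrable_arctan_coeff[OF assms] by simp
    show "\<forall>\<^sub>F R in at_top. AE r in \<nu>.
        norm (arctan_coeff w v r * arctan (R / r)) \<le> \<bar>arctan_coeff w v r\<bar> * (pi / 2)"
      by (simp only: real_norm_def abs_mult_arctan_le) simp
    show "AE r in \<nu>. ((\<lambda>R. arctan_coeff w v r * arctan (R / r))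
        \<longlongrightarrow> arctan_coeff w v r * (pi / 2)) at_top"
      using AE_pos
    proof eventually_elim
      case (elim r)
      then have "filterlim (\<lambda>R. R / r) at_top at_top"
        by real_asymp
      then show ?case
        by (intro tendsto_mult_left filterlim_compose[OF tendsto_arctan_at_top])
    qed
  qed measurable
  from tendsto_diff[OF log tendsto_mult_left[OF this, of 2]] show ?thesis
    by (simp add: eq mult.commute)
qed

text \<open>For \<open>w\<close> \<noteq> 0 and e < |w|/2, both |w + e| and |w - e| lie between
  |w|/2 and 3|w|/2. Their squares differ by a factor of at most 9, still so after adding r^2, whence
  ln 9. For \<open>w = 0\<close> the two logarithms coincide. The majorant does not depend on
  \<open>e\<close>.\<close>

lemma inner_part_bound:
  assumes "0 < r" "0 < e" "w \<noteq> 0 \<Longrightarrow> e < \<bar>w\<bar> / 2"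
  shows "\<bar>inner_part w v e r\<bar> \<le> \<bar>log_coeff w v r\<bar> * (ln 9 / 2) + \<bar>arctan_coeff w v r\<bar> * pi"
proof -
  let ?p = "(w + e)\<^sup>2 + r\<^sup>2" and ?q = "(w - e)\<^sup>2 + r\<^sup>2"
  have pq: "?p > 0" "?q > 0"
    using assms by (simp_all add: sum_squares_pos)
  have "\<bar>ln ?p - ln ?q\<bar> \<le> ln 9"
  proof (cases "w = 0")
    case False
    have "\<bar>w + e\<bar> \<le> 3 * \<bar>w - e\<bar>" "\<bar>w - e\<bar> \<le> 3 * \<bar>w + e\<bar>"
      using assms(2) assms(3)[OF False] abs_triangle_ineq[of w e] abs_triangle_ineq4[of w e]
        abs_triangle_ineq2[of w e] abs_triangle_ineq2[of w "- e"]
      by simp_all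
    from power_mono[OF this(1), of 2] power_mono[OF this(2), of 2]
    have "(w + e)\<^sup>2 \<le> 9 * (w - e)\<^sup>2" "(w - e)\<^sup>2 \<le> 9 * (w + e)\<^sup>2"
      by (simp_all add: power_mult_distrib)
    moreover have "X + r\<^sup>2 \<le> 9 * (Y + r\<^sup>2)" if "X \<le> 9 * Y" for X Y :: real
      using that by (simp add: distrib_left add_mono)
    ultimately have "?p \<le> 9 * ?q" "?q \<le> 9 * ?p"
      by blast+
    moreover have "ln X \<le> ln 9 + ln Y" if "0 < X" "0 < Y" "X \<le> 9 * Y" for X Y :: real
      using that ln_le_cancel_iff[of X "9 * Y"] by (simp add: ln_mult)
    ultimately have "ln ?p \<le> ln 9 + ln ?q" "ln ?q \<le> ln 9 + ln ?p"
      using pq by blast+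
    then show ?thesis
      by linarith
  qed simp
  then have "\<bar>log_coeff w v r * ((ln ?p - ln ?q) / 2)\<bar> \<le> \<bar>log_coeff w v r\<bar> * (ln 9 / 2)"
    by (simp add: abs_mult mult_left_mono)
  moreover have "\<bar>arctan ((w + e) / r) - arctan ((w - e) / r)\<bar> \<le> pi"
    using arctan_bounded[of "(w + e) / r"] arctan_bounded[of "(w - e) / r"] by (simp add: abs_le_iff)
  then have "\<bar>arctan_coeff w v r * (arctan ((w + e) / r) - arctan ((w - e) / r))\<bar>
      \<le> \<bar>arctan_coeff w v r\<bar> * pi"
    by (simp add: abs_mult mult_left_mono)
  ultimately show ?thesis
    unfolding inner_part_def by linarith
qed

lemma integrable_inner_part_bound:
  "w \<noteq> v \<Longrightarrow> integrable \<nu> (\<lambda>r. \<bar>log_coeff w v r\<bar> * (ln 9 / 2) + \<bar>arctan_coeff w v r\<bar> * pi)"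
  using integrable_log_coeff integrable_arctan_coeff by auto

lemma integrable_inner_part:
  assumes "w \<noteq> v" "0 < e" "w \<noteq> 0 \<Longrightarrow> e < \<bar>w\<bar> / 2"
  shows "integrable \<nu> (inner_part w v e)"
proof (rule Bochner_Integration.integrable_bound[OF integrable_inner_part_bound[OF assms(1)]])
  show "AE r in \<nu>. norm (inner_part w v e r)
      \<le> norm (\<bar>log_coeff w v r\<bar> * (ln 9 / 2) + \<bar>arctan_coeff w v r\<bar> * pi)"
    using AE_pos by eventually_elim (unfold real_norm_def, rule order_trans[OF inner_part_bound[OF _ assms(2,3)] abs_ge_self])
qed measurable

text \<open>The bound \<open>e < 1\<close> makes the threshold |w| + 1 < R sufficient for all these
  \<open>e\<close>, so that the conditions on \<open>e\<close> and \<open>R\<close> separate as a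
  product filter requires.\<close>

lemma eventually_small_excision:
  fixes w :: real
  shows "eventually (\<lambda>e. 0 < e \<and> e < 1 \<and> (w \<noteq> 0 \<longrightarrow> e < \<bar>w\<bar> / 2)) (at_right 0)"
proof -
  have "eventually (\<lambda>e. e \<in> {0<..<if w = 0 then 1 else min 1 (\<bar>w\<bar> / 2)}) (at_right 0)"
    by (rule eventually_at_right_real) simp
  then show ?thesis
    by eventually_elim (auto split: if_splits)
qed

text \<open>For fixed r > 0 the integrand is continuous in \<open>e\<close> and vanishes at
  \<open>e = 0\<close>, where the two logarithms and the two arctangents coincide.\<close>

lemma integral_inner_part_tendsto:
  assumes "w \<noteq> v"
  shows "((\<lambda>e. LINT r|\<nu>. inner_part w v e r) \<longlongrightarrow> 0) (at_right 0)"
proof -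
  \<comment> \<open>The substitution e = 1/s turns the limit at 0 from the right into one at
    infinity, where dominated convergence is applied.\<close>
  have "((\<lambda>s. LINT r|\<nu>. inner_part w v (inverse s) r) \<longlongrightarrow> (LINT r|\<nu>. 0)) at_top"
  proof (rule integral_dominated_convergence_at_top)
    show "integrable \<nu> (\<lambda>r. \<bar>log_coeff w v r\<bar> * (ln 9 / 2) + \<bar>arctan_coeff w v r\<bar> * pi)"
      by (rule integrable_inner_part_bound[OF assms])
    have "\<forall>\<^sub>F e in at_right 0. AE r in \<nu>. norm (inner_part w v e r)
        \<le> \<bar>log_coeff w v r\<bar> * (ln 9 / 2) + \<bar>arctan_coeff w v r\<bar> * pi"
      using eventually_small_excision[of w]
    proof eventually_elim
      case (elim e)
      show ?case
        using AE_pos by eventually_elim (use inner_part_bound[of _ e w v] elim in auto)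
    qed
    then show "\<forall>\<^sub>F s in at_top. AE r in \<nu>. norm (inner_part w v (inverse s) r)
        \<le> \<bar>log_coeff w v r\<bar> * (ln 9 / 2) + \<bar>arctan_coeff w v r\<bar> * pi"
      by (simp add: eventually_at_right_to_top)
    show "AE r in \<nu>. ((\<lambda>s. inner_part w v (inverse s) r) \<longlongrightarrow> 0) at_top"
      using AE_pos
    proof eventually_elim
      case (elim r)
      then have "isCont (\<lambda>e. inner_part w v e r) 0"
        unfolding inner_part_def
        by (intro continuous_intros) (use sum_squares_pos[OF elim, of w] in auto)
      then have "((\<lambda>e. inner_part w v e r) \<longlongrightarrow> inner_part w v 0 r) (at_right 0)"
        unfolding isCont_def by (rule filterlim_mono) (auto simp: at_le)
      then show ?case
        by (simp add: filterlim_at_right_to_top inner_part_def)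
    qed
  qed measurable
  then show ?thesis
    by (simp add: filterlim_at_right_to_top)
qed

text \<open>For small \<open>e\<close> and large \<open>R\<close> the truncated integral equals a
  function of \<open>R\<close> plus a function of \<open>e\<close>, so the joint limit is the sum of
  two separate limits.\<close>

lemma has_pv_integral_divided_difference:
  assumes "w \<noteq> v"
  shows "has_pv_integral (\<lambda>x. (dispersion \<nu> x - dispersion \<nu> v) / ((x - v) * (x - w))) w
    (- (pi * (LINT r|\<nu>. arctan_coeff w v r)))"
  unfolding has_pv_integral_def
proof (intro conjI allI impI)
  let ?F = "\<lambda>x. (dispersion \<nu> x - dispersion \<nu> v) / ((x - v) * (x - w))"
  let ?T = "\<lambda>e R. {-R..R} - {w-e<..<w+e}"
  \<comment> \<open>Here \<open>R\<close> may be negative, so integrability is inherited from the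
    truncation at |R|.\<close>
  show "set_integrable lborel (?T e R) ?F" if "0 < e" for e R
    by (rule set_integrable_subset[OF truncated_divided_difference(1)[of e "\<bar>R\<bar>" w]]) (use that in auto)
  have "((\<lambda>(e, R). (LINT r|\<nu>. outer_part w v R r) + (LINT r|\<nu>. inner_part w v e r))
      \<longlongrightarrow> - (pi * (LINT r|\<nu>. arctan_coeff w v r)) + 0) (at_right 0 \<times>\<^sub>F at_top)"
    unfolding case_prod_beta
    by (intro tendsto_add
        filterlim_compose[OF integral_outer_part_tendsto[OF assms] filterlim_snd]
        filterlim_compose[OF integral_inner_part_tendsto[OF assms] filterlim_fst])
  moreover have "\<forall>\<^sub>F (e, R) in at_right 0 \<times>\<^sub>F at_top.
      (LINT r|\<nu>. outer_part w v R r) + (LINT r|\<nu>. inner_part w v e r) = (LINT x:?T e R|lborel. ?F x)"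
    unfolding eventually_prod_filter
  proof (intro exI conjI allI impI)
    show "\<forall>\<^sub>F e in at_right 0. 0 < e \<and> e < 1 \<and> (w \<noteq> 0 \<longrightarrow> e < \<bar>w\<bar> / 2)"
      by (rule eventually_small_excision)
    show "\<forall>\<^sub>F R in at_top. \<bar>w\<bar> + 1 < R"
      by (rule eventually_gt_at_top)
    fix e R :: real
    assume e: "0 < e \<and> e < 1 \<and> (w \<noteq> 0 \<longrightarrow> e < \<bar>w\<bar> / 2)" and R: "\<bar>w\<bar> + 1 < R"
    have "(LINT x:?T e R|lborel. ?F x) = (LINT r|\<nu>. (LINT x:?T e R|lborel. subtracted_kernel w v r x))"
      using e R by (intro truncated_divided_difference) auto
    also have "\<dots> = (LINT r|\<nu>. outer_part w v R r + inner_part w v e r)"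
    proof (rule integral_cong_AE)
      show "AE r in \<nu>. (LINT x:?T e R|lborel. subtracted_kernel w v r x)
          = outer_part w v R r + inner_part w v e r"
        using AE_pos by eventually_elim (rule truncated_kernel_integral; use e R in auto)
    qed (unfold set_lebesgue_integral_def, measurable)
    also have "\<dots> = (LINT r|\<nu>. outer_part w v R r) + (LINT r|\<nu>. inner_part w v e r)"
      using e by (intro Bochner_Integration.integral_add integrable_outer_part integrable_inner_part assms) auto
    finally show "case (e, R) of (e, R) \<Rightarrow>
        (LINT r|\<nu>. outer_part w v R r) + (LINT r|\<nu>. inner_part w v e r) = (LINT x:?T e R|lborel. ?F x)"
      by simp
  qed
  ultimately show "((\<lambda>(e, R). LINT x:?T e R|lborel. ?F x)
      \<longlongrightarrow> - (pi * (LINT r|\<nu>. arctan_coeff w v r))) (at_right 0 \<times>\<^sub>F at_top)"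
    by (subst (asm) filterlim_cong[OF refl refl]) (auto elim: eventually_mono)
qed

end

section \<open>Uniqueness of the principal value and conclusion\<close>

lemma has_pv_integral_unique:
  assumes "has_pv_integral f c I" "has_pv_integral f c J"
  shows "I = J"
proof (rule tendsto_unique)
  show "at_right (0::real) \<times>\<^sub>F (at_top :: real filter) \<noteq> bot"
    by (simp add: prod_filter_eq_bot)
qed (use assms in \<open>auto simp: has_pv_integral_def\<close>)

lemma pv_integral_eqI: "has_pv_integral f c I \<Longrightarrow> pv_integral f c = I"
  unfolding pv_integral_def using has_pv_integral_unique by blast

text \<open>Compact intervals exhaust the positive half-line and have finite measure, and the
  complement of the half-line is null; this gives sigma-finiteness.\<close>

lemma spectral_measure_radon_on_pos:
  assumes "radon_on_pos \<nu>" "set_integrable \<nu> {0<..} (\<lambda>r. 1 / (1 + r))"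
  shows "spectral_measure \<nu>"
proof -
  have sets [measurable_cong]: "sets \<nu> = sets borel" and null: "emeasure \<nu> {..0} = 0"
    and compact: "\<And>K. compact K \<Longrightarrow> K \<subseteq> {0<..} \<Longrightarrow> emeasure \<nu> K < \<infinity>"
    using assms(1) by (auto simp: radon_on_pos_def)
  have pos: "AE r in \<nu>. 0 < r"
    by (rule AE_I[OF _ null]) (auto simp: sets)
  show ?thesis
  proof
    \<comment> \<open>With n + 1 in place of n the interval for n = 0 is {1}; 1/0 = 0 would put the
      endpoint 0 into it.\<close>
    let ?A = "insert {..0} (range (\<lambda>n::nat. {1 / (real n + 1)..real n + 1}))"
    have "\<exists>n::nat. r \<in> {1 / (real n + 1)..real n + 1}" if "0 < r" for r
    proof -
      obtain n :: nat where n: "max r (1 / r) < real n"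
        using reals_Archimedean2 by blast
      then have "1 / (real n + 1) \<le> r"
        using that by (simp add: field_simps)
      with n show ?thesis by auto
    qed
    then have "r \<in> \<Union> ?A" for r
    proof (cases "0 < r")
      case True
      with \<open>\<And>r. 0 < r \<Longrightarrow> _\<close> show ?thesis by blast
    next
      case False
      then have "r \<in> {..0}" by simp
      then show ?thesis by blast
    qed
    then have "\<Union> ?A = UNIV"
      by blast
    moreover have "emeasure \<nu> {1 / (real n + 1)..real n + 1} < \<infinity>" for n :: nat
      by (rule compact) (auto intro: less_le_trans[of 0 "1 / (real n + 1)"])
    then have "emeasure \<nu> a \<noteq> \<infinity>" if "a \<in> ?A" for a
      using that null by (auto simp: less_top)
    ultimately show "\<exists>A. countable A \<and> A \<subseteq> sets \<nu> \<and> \<Union> A = space \<nu> \<and> (\<forall>a\<in>A. emeasure \<nu> a \<noteq> \<infinity>)"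
      using sets_eq_imp_space_eq[OF sets] by (intro exI[of _ ?A]) (auto simp: sets)
    have "integrable \<nu> (\<lambda>r. indicator {0<..} r *\<^sub>R (1 / (1 + r))) \<longleftrightarrow> integrable \<nu> (\<lambda>r. 1 / (1 + r))"
    proof (rule integrable_cong_AE)
      show "AE r in \<nu>. indicator {0<..} r *\<^sub>R (1 / (1 + r)) = 1 / (1 + r)"
        using pos by eventually_elim simp
    qed measurable
    then show "integrable \<nu> (\<lambda>r. 1 / (1 + r))"
      using assms(2) by (simp add: set_integrable_def)
  qed (fact sets pos)+
qed

theorem mainTheorem2:
  fixes \<rho> \<alpha> \<omega> \<omega>\<^sub>0 :: real and G l :: "real \<Rightarrow> real" and \<nu> :: "real measure"
  assumes "\<rho> > 0"
    and "completely_monotonic G" and "locally_integrable_at_0 G" and "\<exists>t>0. G t \<noteq> 0"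
    and "dispersion_attenuation_measure \<rho> G \<nu>"
    and "slowly_varying l"
    and "(\<lambda>r. measure \<nu> {0..r}) \<sim>[at_top] (\<lambda>r. r powr (1 - \<alpha>) * l r)"
    and "\<omega> \<noteq> \<omega>\<^sub>0"
  shows "pv_integrable (\<lambda>x. (dispersion \<nu> x - dispersion \<nu> \<omega>\<^sub>0) / ((x - \<omega>\<^sub>0) * (x - \<omega>))) \<omega> \<and>
    attenuation \<nu> \<omega> - attenuation \<nu> \<omega>\<^sub>0 =
      - (\<omega> - \<omega>\<^sub>0) / pi *
        pv_integral (\<lambda>x. (dispersion \<nu> x - dispersion \<nu> \<omega>\<^sub>0) / ((x - \<omega>\<^sub>0) * (x - \<omega>))) \<omega>"
proof -
  interpret spectral_measure \<nu>
    using assms(5) by (intro spectral_measure_radon_on_pos) (auto simp: dispersion_attenuation_measure_def)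
  \<comment> \<open>With c = \<open>\<omega> - \<omega>\<^sub>0\<close> and \<open>I\<close> the
    integral of \<open>arctan_coeff\<close>, the prefactor times the principal value becomes the
    right-hand side of \<open>attenuation_diff\<close>.\<close>
  have cancel: "- c / pi * - (pi * I) = c * I" for c I :: real
    by simp
  note pv = has_pv_integral_divided_difference[OF assms(8)]
  show ?thesis
    unfolding pv_integrable_def pv_integral_eqI[OF pv] attenuation_diff[OF assms(8)] cancel
    using pv by blast
qed

end
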